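(* Let $\mathbb{F}$ be a field of characteristic $0$, let $Z=\{P_1,\dots,P_r\}$ be a set of $r$ distinct points in $\mathbb{P}^n$ over $\mathbb{F}$, and let $d,m$ be positive integers with $\binom{d+n}{n}=\binom{m+n-1}{n}+r+1$. Let $F(a_0,\dots,a_n,x_0,\dots,x_n)=\det M$, where $M$ is the interpolation matrix of $(Z,d,m)$. Let $B=(b_0,\dots,b_n)\in\mathbb{P}^n$ (with fixed coordinates) and define homogeneous polynomials in $\mathbb{F}[x_0,\dots,x_n]$ by $$F_L:=F(b_0,\dots,b_n,x_0,\dots,x_n),\qquad F_R:=F(x_0,\dots,x_n,b_0,\dots,b_n).$$ If $F_L\not\equiv 0$, then for all nonnegative integers $t_0,\dots,t_n$ with $t_0+\cdots+t_n=m$, $$\frac{\partial^m F_L}{\partial x_0^{t_0}\cdots\partial x_n^{t_n}}(b_0,\dots,b_n)=(-1)^m\,\frac{\partial^m F_R}{\partial x_0^{t_0}\cdots\partial x_n^{t_n}}(b_0,\dots,b_n).$$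
   Context: Interpolation matrix. Fix coordinates $(p_{i0},\dots,p_{in})$ of each $P_i$. Let $w=w(a_0,\dots,a_n)$ be the row vector of all $\binom{d+n}{n}$ monomials of degree $d$ in $a_0,\dots,a_n$, in some fixed order. For a tuple $Q=(q_0,\dots,q_n)$, $w(Q)$ denotes $w$ with $q_i$ substituted for $a_i$. The interpolation matrix $M$ is the square matrix of size $\binom{d+n}{n}$ with entries in $\mathbb{F}[a_0,\dots,a_n,x_0,\dots,x_n]$ whose rows are, in order: the $\binom{m+n-1}{n}$ rows $\frac{\partial^{m-1}}{\partial a_0^{t_0}\cdots\partial a_n^{t_n}}w$ for all $(t_0,\dots,t_n)\in\mathbb{Z}_{\ge0}^{n+1}$ with $t_0+\cdots+t_n=m-1$ (derivatives taken entrywise, in some fixed order); then the $r$ rows $w(P_1),\dots,w(P_r)$; and finally the row $w(x_0,\dots,x_n)$. *)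

theory Defs
  imports
    "HOL-Library.Poly_Mapping"
    "Jordan_Normal_Form.Determinant"
begin

text \<open>Finitely supported functions from exponent vectors to coefficients, with the
  convolution product of Poly_Mapping, are the polynomials in the variables \<open>'v\<close>.\<close>

type_synonym ('v, 'a) mpoly = "('v \<Rightarrow>\<^sub>0 nat) \<Rightarrow>\<^sub>0 'a"

definition Const :: "'a::comm_ring_1 \<Rightarrow> ('v, 'a) mpoly" where
  "Const c = Poly_Mapping.single 0 c"

definition Var :: "'v \<Rightarrow> ('v, 'a::comm_ring_1) mpoly" where
  "Var v = Poly_Mapping.single (Poly_Mapping.single v 1) 1"

definition mpoly_eval :: "('v \<Rightarrow> 'a) \<Rightarrow> ('v, 'a::comm_ring_1) mpoly \<Rightarrow> 'a" where
  "mpoly_eval f p = (\<Sum>e\<in>Poly_Mapping.keys p. Poly_Mapping.lookup p e *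
     (\<Prod>v\<in>Poly_Mapping.keys e. f v ^ Poly_Mapping.lookup e v))"

definition mpoly_subst ::
  "('v \<Rightarrow> ('w, 'a) mpoly) \<Rightarrow> ('v, 'a::comm_ring_1) mpoly \<Rightarrow> ('w, 'a) mpoly" where
  "mpoly_subst f p = (\<Sum>e\<in>Poly_Mapping.keys p. Const (Poly_Mapping.lookup p e) *
     (\<Prod>v\<in>Poly_Mapping.keys e. f v ^ Poly_Mapping.lookup e v))"

text \<open>If \<open>v\<close> does not occur in a monomial, the exponent subtraction truncates, but the
  coefficient is then zero.\<close>

definition partial_deriv :: "'v \<Rightarrow> ('v, 'a::comm_ring_1) mpoly \<Rightarrow> ('v, 'a) mpoly" where
  "partial_deriv v p = (\<Sum>e\<in>Poly_Mapping.keys p.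
     Poly_Mapping.single (e - Poly_Mapping.single v 1)
       (of_nat (Poly_Mapping.lookup e v) * Poly_Mapping.lookup p e))"

text \<open>The operator \<open>\<partial>^(t\<^sub>0 + \<dots> + t\<^sub>n) / \<partial>v\<^sub>0^t\<^sub>0 \<dots> \<partial>v\<^sub>n^t\<^sub>n\<close>.\<close>

definition iter_deriv ::
  "nat \<Rightarrow> (nat \<Rightarrow> 'v) \<Rightarrow> (nat \<Rightarrow>\<^sub>0 nat) \<Rightarrow> ('v, 'a::comm_ring_1) mpoly \<Rightarrow> ('v, 'a) mpoly" where
  "iter_deriv n v t = fold (\<lambda>i. partial_deriv (v i) ^^ Poly_Mapping.lookup t i) [0..<Suc n]"

definition exponents :: "nat \<Rightarrow> nat \<Rightarrow> (nat \<Rightarrow>\<^sub>0 nat) set" where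
  "exponents n k = {t. Poly_Mapping.keys t \<subseteq> {..n} \<and> (\<Sum>i\<le>n. Poly_Mapping.lookup t i) = k}"

definition hom_coords :: "nat \<Rightarrow> 'a::field vec set" where
  "hom_coords n = carrier_vec (Suc n) - {0\<^sub>v (Suc n)}"

definition proj_rel :: "nat \<Rightarrow> ('a::field vec \<times> 'a vec) set" where
  "proj_rel n = {(u, v). u \<in> hom_coords n \<and> v \<in> hom_coords n \<and> (\<exists>c. c \<noteq> 0 \<and> v = c \<cdot>\<^sub>v u)}"

definition proj_space :: "nat \<Rightarrow> 'a::field vec set set" where
  "proj_space n = hom_coords n // proj_rel n"

datatype var = AVar nat | XVar nat

text \<open>In the following, \<open>E\<close> lists the exponents of the monomials of degree \<open>d\<close>, \<open>T\<close> lists the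
  orders of differentiation of total order \<open>m - 1\<close>, and \<open>ps\<close> lists coordinate vectors of
  the points.\<close>

definition monomial_row :: "nat \<Rightarrow> (nat \<Rightarrow>\<^sub>0 nat) list \<Rightarrow> (nat \<Rightarrow> 'b::comm_ring_1) \<Rightarrow> 'b vec" where
  "monomial_row n E q = vec_of_list (map (\<lambda>e. \<Prod>i\<le>n. q i ^ Poly_Mapping.lookup e i) E)"

definition interpolation_matrix ::
  "nat \<Rightarrow> (nat \<Rightarrow>\<^sub>0 nat) list \<Rightarrow> (nat \<Rightarrow>\<^sub>0 nat) list \<Rightarrow> 'a::field vec list
    \<Rightarrow> (var, 'a) mpoly mat" where
  "interpolation_matrix n E T ps = mat_of_rows (length E)
     (map (\<lambda>t. map_vec (iter_deriv n AVar t) (monomial_row n E (\<lambda>i. Var (AVar i)))) T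
      @ map (\<lambda>p. monomial_row n E (\<lambda>i. Const (p $ i))) ps
      @ [monomial_row n E (\<lambda>i. Var (XVar i))])"

text \<open>\<open>F(b\<^sub>0,\<dots>,b\<^sub>n,x\<^sub>0,\<dots>,x\<^sub>n)\<close> and \<open>F(x\<^sub>0,\<dots>,x\<^sub>n,b\<^sub>0,\<dots>,b\<^sub>n)\<close>,
  where the variable \<open>i\<close> of the result stands for \<open>x\<^sub>i\<close>.\<close>

definition left_poly :: "'a::field vec \<Rightarrow> (var, 'a) mpoly \<Rightarrow> (nat, 'a) mpoly" where
  "left_poly b = mpoly_subst (\<lambda>v. case v of AVar i \<Rightarrow> Const (b $ i) | XVar i \<Rightarrow> Var i)"

definition right_poly :: "'a::field vec \<Rightarrow> (var, 'a) mpoly \<Rightarrow> (nat, 'a) mpoly" where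
  "right_poly b = mpoly_subst (\<lambda>v. case v of AVar i \<Rightarrow> Var i | XVar i \<Rightarrow> Const (b $ i))"

end

theory Submission
  imports Defs
begin

text \<open>On the diagonal \<open>x = a\<close> the last row of the interpolation matrix becomes, after
  \<open>m - 1\<close> differentiations in \<open>x\<close>, one of the derivative rows, so every
  \<open>x\<close>-derivative of \<open>F\<close> of order \<open>m - 1\<close> vanishes there; by
  Euler's relation in \<open>x\<close>, where the degree \<open>d\<close> exceeds \<open>m - 1\<close> by the
  binomial identity, so do those of lower order. Hence \<open>F(a, a + h)\<close> starts with a form
  \<open>G(a, h)\<close> of degree \<open>m\<close> in \<open>h\<close>, and \<open>F(b + h, b)\<close> starts with
  \<open>G(b, -h) = (-1)^m G(b, h)\<close>, which is the claim. The expansion is avoided by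
  differentiating along the diagonal.\<close>

subsection \<open>Polynomials as finitely supported functions\<close>

text \<open>Updating at a key outside the support amounts to adding a single term, so additive
  properties need checking on single terms only.\<close>

lemma poly_mapping_single_add_induct [case_names single add]:
  assumes "\<And>k c. P (Poly_Mapping.single k c)"
    and "\<And>f g. P f \<Longrightarrow> P g \<Longrightarrow> P (f + g)"
  shows "P (f :: 'k \<Rightarrow>\<^sub>0 'c::comm_monoid_add)"
proof (induction f rule: update_induct)
  case const
  show ?case using assms(1)[of undefined 0] by simp
next
  case (update f a b)
  have "Poly_Mapping.update a b f = Poly_Mapping.single a b + f"
    using update.hyps
    by (intro poly_mapping_eqI) (auto simp: lookup_update lookup_add lookup_single when_def in_keys_iff)
  then show ?case using assms(1)[of a b] assms(2) update by metis
qed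

lemma mpoly_induct [case_names Const Var add mult]:
  fixes p :: "('v, 'a::comm_ring_1) mpoly"
  assumes Const: "\<And>c. P (Const c)" and Var: "\<And>v. P (Var v)"
    and add: "\<And>p q. P p \<Longrightarrow> P q \<Longrightarrow> P (p + q)"
    and mult: "\<And>p q. P p \<Longrightarrow> P q \<Longrightarrow> P (p * q)"
  shows "P p"
proof (induction p rule: poly_mapping_single_add_induct)
  case (single e c)
  show ?case
  \<comment> \<open>The exponent vector is itself finitely supported, so the same induction splits
    the monomial into powers of single variables.\<close>
  proof (induction e arbitrary: c rule: poly_mapping_single_add_induct)
    case (single v k)
    show ?case
    proof (induction k arbitrary: c)
      case 0
      show ?case using Const[of c] by (simp add: Const_def)
    next
      case (Suc k)
      have "Poly_Mapping.single (Poly_Mapping.single v (Suc k)) c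
          = Var v * Poly_Mapping.single (Poly_Mapping.single v k) c"
        by (simp add: Var_def mult_single flip: single_add)
      then show ?case using mult[OF Var Suc] by simp
    qed
  next
    case (add e e')
    have "Poly_Mapping.single (e + e') c = Poly_Mapping.single e c * Poly_Mapping.single e' 1"
      by (simp add: mult_single)
    then show ?case using mult[OF add] by simp
  qed
qed (rule add)

lemma Const_0 [simp]: "Const 0 = 0" and Const_1 [simp]: "Const 1 = 1"
  by (simp_all add: Const_def)

lemma Const_add: "Const (a + b) = Const a + Const b"
  and Const_diff: "Const (a - b) = Const a - Const b"
  and Const_mult: "Const (a * b) = Const a * Const b"
  by (simp_all add: Const_def single_add single_diff mult_single)

text \<open>All three products extend to the union of the supports, since the added factors have
  exponent 0. This makes evaluation and substitution multiplicative.\<close>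

lemma prod_keys_add:
  fixes f :: "'v \<Rightarrow> 'b::comm_monoid_mult" and e e' :: "'v \<Rightarrow>\<^sub>0 nat"
  shows "(\<Prod>v\<in>Poly_Mapping.keys (e + e'). f v ^ Poly_Mapping.lookup (e + e') v)
    = (\<Prod>v\<in>Poly_Mapping.keys e. f v ^ Poly_Mapping.lookup e v)
      * (\<Prod>v\<in>Poly_Mapping.keys e'. f v ^ Poly_Mapping.lookup e' v)"
proof -
  let ?K = "Poly_Mapping.keys e \<union> Poly_Mapping.keys e'"
  have "(\<Prod>v\<in>Poly_Mapping.keys g. f v ^ Poly_Mapping.lookup g v)
      = (\<Prod>v\<in>?K. f v ^ Poly_Mapping.lookup g v)" if "Poly_Mapping.keys g \<subseteq> ?K" for g
    by (rule prod.mono_neutral_left) (use that in \<open>auto simp: in_keys_iff\<close>)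
  from this[OF keys_add] this[of e] this[of e'] show ?thesis
    by (simp only: lookup_add power_add prod.distrib Un_upper1 Un_upper2)
qed

section \<open>Evaluation and substitution as ring homomorphisms\<close>

context
  fixes f :: "'v \<Rightarrow> 'a::comm_ring_1"
begin

lemma mpoly_eval_single:
  "mpoly_eval f (Poly_Mapping.single e c)
    = c * (\<Prod>v\<in>Poly_Mapping.keys e. f v ^ Poly_Mapping.lookup e v)"
  by (simp add: mpoly_eval_def)

lemma mpoly_eval_add [simp]: "mpoly_eval f (p + q) = mpoly_eval f p + mpoly_eval f q"
  unfolding mpoly_eval_def by (rule setsum_keys_plus_distrib) (simp_all add: algebra_simps)

lemma mpoly_eval_uminus: "mpoly_eval f (- p) = - mpoly_eval f p"
  using mpoly_eval_add[of "- p" p] by (simp add: mpoly_eval_def eq_neg_iff_add_eq_0)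

lemma mpoly_eval_Const [simp]: "mpoly_eval f (Const c) = c"
  by (simp add: Const_def mpoly_eval_single)

lemma mpoly_eval_Var [simp]: "mpoly_eval f (Var v) = f v"
  by (simp add: Var_def mpoly_eval_single)

lemma mpoly_eval_mult [simp]: "mpoly_eval f (p * q) = mpoly_eval f p * mpoly_eval f q"
proof (induction p rule: poly_mapping_single_add_induct)
  case (single e c)
  show ?case
    by (induction q rule: poly_mapping_single_add_induct)
      (simp_all add: mult_single mpoly_eval_single prod_keys_add algebra_simps)
qed (simp add: algebra_simps)

end

context
  fixes f :: "'v \<Rightarrow> ('w, 'a::comm_ring_1) mpoly"
begin

lemma mpoly_subst_single:
  "mpoly_subst f (Poly_Mapping.single e c)
    = Const c * (\<Prod>v\<in>Poly_Mapping.keys e. f v ^ Poly_Mapping.lookup e v)"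
  by (simp add: mpoly_subst_def)

lemma mpoly_subst_add [simp]: "mpoly_subst f (p + q) = mpoly_subst f p + mpoly_subst f q"
  unfolding mpoly_subst_def
  by (rule setsum_keys_plus_distrib) (simp_all add: Const_add algebra_simps)

lemma mpoly_subst_Const [simp]: "mpoly_subst f (Const c) = Const c"
  using mpoly_subst_single[of 0 c] by (simp add: Const_def)

lemma mpoly_subst_Var [simp]: "mpoly_subst f (Var v) = f v"
  by (simp add: Var_def mpoly_subst_single)

lemma mpoly_subst_mult [simp]: "mpoly_subst f (p * q) = mpoly_subst f p * mpoly_subst f q"
proof (induction p rule: poly_mapping_single_add_induct)
  case (single e c)
  show ?case
    by (induction q rule: poly_mapping_single_add_induct)
      (simp_all add: mult_single mpoly_subst_single prod_keys_add Const_mult algebra_simps)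
qed (simp add: algebra_simps)

lemma mpoly_subst_0 [simp]: "mpoly_subst f 0 = 0"
  and mpoly_subst_1 [simp]: "mpoly_subst f 1 = 1"
  using mpoly_subst_Const[of 0] mpoly_subst_Const[of 1] by simp_all

lemma mpoly_subst_sum [simp]: "mpoly_subst f (sum g S) = (\<Sum>i\<in>S. mpoly_subst f (g i))"
  by (induction S rule: infinite_finite_induct) simp_all

lemma mpoly_subst_prod [simp]: "mpoly_subst f (prod g S) = (\<Prod>i\<in>S. mpoly_subst f (g i))"
  by (induction S rule: infinite_finite_induct) simp_all

lemma mpoly_subst_power [simp]: "mpoly_subst f (p ^ k) = mpoly_subst f p ^ k"
  by (induction k) simp_all

end

lemma mpoly_eval_subst:
  "mpoly_eval f (mpoly_subst g p) = mpoly_eval (\<lambda>v. mpoly_eval f (g v)) p"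
  by (induction p rule: mpoly_induct) simp_all

subsection \<open>Partial derivatives\<close>

lemma partial_deriv_single:
  "partial_deriv v (Poly_Mapping.single e c)
    = Poly_Mapping.single (e - Poly_Mapping.single v 1) (of_nat (Poly_Mapping.lookup e v) * c)"
  by (simp add: partial_deriv_def)

lemma partial_deriv_add [simp]:
  "partial_deriv v (p + q) = partial_deriv v p + partial_deriv v q"
  unfolding partial_deriv_def
  by (rule setsum_keys_plus_distrib) (simp_all add: single_add algebra_simps)

lemma partial_deriv_Const [simp]: "partial_deriv v (Const c) = 0"
  by (simp add: Const_def partial_deriv_single)

lemma partial_deriv_Var [simp]: "partial_deriv v (Var w) = (if v = w then 1 else 0)"
  by (simp add: Var_def partial_deriv_single lookup_single when_def)

lemma diff_single_add:
  fixes e e' :: "'v \<Rightarrow>\<^sub>0 nat"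
  assumes "Poly_Mapping.lookup e v \<noteq> 0"
  shows "e + e' - Poly_Mapping.single v 1 = (e - Poly_Mapping.single v 1) + e'"
  using assms
  by (intro poly_mapping_eqI) (auto simp: lookup_add lookup_minus lookup_single when_def)

lemma partial_deriv_mult [simp]:
  "partial_deriv v (p * q) = partial_deriv v p * q + p * partial_deriv v q"
proof (induction p rule: poly_mapping_single_add_induct)
  case (single e c)
  show ?case
  proof (induction q rule: poly_mapping_single_add_induct)
    case (single e' c')
    let ?l = "Poly_Mapping.lookup e v" and ?l' = "Poly_Mapping.lookup e' v"
    \<comment> \<open>The two exponents can differ only where subtraction truncates, that is for
      \<open>?l = 0\<close>, and then the coefficient is 0.\<close>
    have "Poly_Mapping.single (e + e' - Poly_Mapping.single v 1) (of_nat ?l * (c * c'))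
      = Poly_Mapping.single ((e - Poly_Mapping.single v 1) + e') (of_nat ?l * (c * c'))"
      using diff_single_add[of e v e'] by (cases "?l = 0") simp_all
    moreover have "Poly_Mapping.single (e + e' - Poly_Mapping.single v 1) (of_nat ?l' * (c * c'))
      = Poly_Mapping.single (e + (e' - Poly_Mapping.single v 1)) (of_nat ?l' * (c * c'))"
      using diff_single_add[of e' v e] by (cases "?l' = 0") (simp_all add: add.commute)
    ultimately show ?case
      by (simp only: mult_single partial_deriv_single lookup_add of_nat_add distrib_right single_add)
        (simp only: mult.assoc mult.left_commute)
  qed (simp add: algebra_simps)
qed (simp add: algebra_simps)

lemma partial_deriv_0 [simp]: "partial_deriv v 0 = 0"
  and partial_deriv_1 [simp]: "partial_deriv v 1 = 0"
  using partial_deriv_Const[of v 0] partial_deriv_Const[of v 1] by simp_all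

lemma partial_deriv_uminus [simp]: "partial_deriv v (- p) = - partial_deriv v p"
  using partial_deriv_add[of v p "- p"] by (simp add: eq_neg_iff_add_eq_0 add.commute)

lemma partial_deriv_sum [simp]: "partial_deriv v (sum f S) = (\<Sum>i\<in>S. partial_deriv v (f i))"
  by (induction S rule: infinite_finite_induct) simp_all

lemma partial_deriv_commute:
  "partial_deriv v (partial_deriv w p) = partial_deriv w (partial_deriv v p)"
  by (induction p rule: mpoly_induct) (simp_all add: algebra_simps)

lemma partial_deriv_prod_0:
  "(\<And>i. i \<in> S \<Longrightarrow> partial_deriv v (f i) = 0) \<Longrightarrow> partial_deriv v (prod f S) = 0"
  by (induction S rule: infinite_finite_induct) simp_all

lemma partial_deriv_power_0: "partial_deriv v p = 0 \<Longrightarrow> partial_deriv v (p ^ k) = 0"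
  by (induction k) simp_all

text \<open>Each product in the Leibniz expansion has only factors with derivative 0; a non-square
  matrix has determinant 0 by definition.\<close>

lemma partial_deriv_det_0:
  assumes "\<And>i j. i < dim_row A \<Longrightarrow> j < dim_col A \<Longrightarrow> partial_deriv v (A $$ (i, j)) = 0"
  shows "partial_deriv v (det A) = 0"
proof (cases "dim_row A = dim_col A")
  case True
  have "partial_deriv v (\<Prod>i = 0..<dim_row A. A $$ (i, p i)) = 0"
    if "p permutes {0..<dim_row A}" for p
    using True permutes_in_image[OF that]
    by (intro partial_deriv_prod_0 assms) (simp_all add: atLeast0LessThan)
  then show ?thesis using True by (auto simp: det_def sign_def intro!: sum.neutral)
qed (simp add: det_def)

text \<open>A list of indices, with repetitions, records the derivatives one at a time and so
  permits induction on the order.\<close>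

definition derivs :: "(nat \<Rightarrow> 'v) \<Rightarrow> nat list \<Rightarrow> ('v, 'a::comm_ring_1) mpoly \<Rightarrow> ('v, 'a) mpoly" where
  "derivs v = fold (\<lambda>i. partial_deriv (v i))"

lemma derivs_Nil [simp]: "derivs v [] p = p"
  and derivs_Cons [simp]: "derivs v (i # is) p = derivs v is (partial_deriv (v i) p)"
  and derivs_append [simp]: "derivs v (is @ js) p = derivs v js (derivs v is p)"
  by (simp_all add: derivs_def)

lemma derivs_0 [simp]: "derivs v is 0 = 0"
  by (induction "is") simp_all

lemma derivs_add: "derivs v is (p + q) = derivs v is p + derivs v is q"
  by (induction "is" arbitrary: p q) simp_all

lemma derivs_sum: "derivs v is (sum f S) = (\<Sum>j\<in>S. derivs v is (f j))"
  by (induction S rule: infinite_finite_induct) (simp_all add: derivs_add)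

lemma partial_deriv_derivs:
  "partial_deriv w (derivs v is p) = derivs v is (partial_deriv w p)"
  by (induction "is" arbitrary: p) (simp_all add: partial_deriv_commute[of w])

lemma derivs_mult_const:
  assumes "\<And>i. partial_deriv (v i) c = 0"
  shows "derivs v is (p * c) = derivs v is p * c"
  by (induction "is" arbitrary: p) (simp_all add: assms)

lemma derivs_mset_cong: "mset is = mset js \<Longrightarrow> derivs v is = derivs v js"
  unfolding derivs_def
  by (rule fold_multiset_equiv) (auto simp: fun_eq_iff partial_deriv_commute)

section \<open>Translation between exponent vectors and lists of indices\<close>

definition exponent_list :: "nat \<Rightarrow> (nat \<Rightarrow>\<^sub>0 nat) \<Rightarrow> nat list" where
  "exponent_list n t = concat (map (\<lambda>i. replicate (Poly_Mapping.lookup t i) i) [0..<Suc n])"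

lemma iter_deriv_eq_derivs:
  fixes p :: "('v, 'a::comm_ring_1) mpoly"
  shows "iter_deriv n v t p = derivs v (exponent_list n t) p"
proof -
  have power: "(partial_deriv (v i) ^^ k) q = derivs v (replicate k i) q"
    for i k and q :: "('v, 'a) mpoly"
    by (induction k) (simp_all add: partial_deriv_derivs)
  have "fold (\<lambda>i. partial_deriv (v i) ^^ Poly_Mapping.lookup t i) is q
      = derivs v (concat (map (\<lambda>i. replicate (Poly_Mapping.lookup t i) i) is)) q"
    for "is" and q :: "('v, 'a) mpoly"
    by (induction "is" arbitrary: q) (simp_all add: power)
  then show ?thesis by (simp add: iter_deriv_def exponent_list_def del: upt_Suc)
qed

lemma set_exponent_list: "set (exponent_list n t) \<subseteq> {..n}"
  by (auto simp: exponent_list_def)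

lemma length_exponent_list: "t \<in> exponents n k \<Longrightarrow> length (exponent_list n t) = k"
  by (simp add: exponent_list_def exponents_def length_concat comp_def interv_sum_list_conv_sum_set_nat
      atLeast0LessThan flip: lessThan_Suc_atMost)

lemma exponents_of_list:
  assumes "set is \<subseteq> {..n}"
  obtains t where "t \<in> exponents n (length is)"
    and "mset (exponent_list n t) = mset is"
proof -
  \<comment> \<open>The witness counts how often each index occurs in the list.\<close>
  define t where "t = (\<Sum>i\<leftarrow>is. Poly_Mapping.single i (1::nat))"
  have lookup: "Poly_Mapping.lookup t i = count_list is i" for i
    unfolding t_def by (induction "is") (simp_all add: lookup_add lookup_single when_def)
  have "t \<in> exponents n (length is)"
    using assms sum_count_set[of "is" "{..n}"]
    by (auto simp: exponents_def lookup in_keys_iff count_list_0_iff)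
  moreover have "mset (concat (map (\<lambda>i. replicate (f i) i) [0..<k])) = (\<Sum>i<k. replicate_mset (f i) i)"
    for f :: "nat \<Rightarrow> nat" and k
    by (induction k) simp_all
  then have "mset (exponent_list n t) = mset is"
    using assms
    by (intro multiset_eqI)
      (auto simp: exponent_list_def lookup count_sum count_mset count_list_0_iff if_distrib sum.delta
        simp del: upt_Suc)
  ultimately show thesis by (rule that)
qed

subsection \<open>Restriction to the diagonal\<close>

text \<open>The common value of \<open>a\<close> and \<open>x\<close> stays a variable, so the
  restriction can be differentiated again.\<close>

definition diagonal :: "(var, 'a::comm_ring_1) mpoly \<Rightarrow> (nat, 'a) mpoly" where
  "diagonal = mpoly_subst (\<lambda>v. case v of AVar i \<Rightarrow> Var i | XVar i \<Rightarrow> Var i)"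

lemma derivs_left_poly: "derivs (\<lambda>i. i) is (left_poly b p) = left_poly b (derivs XVar is p)"
proof -
  have "partial_deriv i (left_poly b q) = left_poly b (partial_deriv (XVar i) q)" for i q
    unfolding left_poly_def by (induction q rule: mpoly_induct) (auto split: var.split)
  then show ?thesis by (induction "is" arbitrary: p) simp_all
qed

lemma derivs_right_poly: "derivs (\<lambda>i. i) is (right_poly b p) = right_poly b (derivs AVar is p)"
proof -
  have "partial_deriv i (right_poly b q) = right_poly b (partial_deriv (AVar i) q)" for i q
    unfolding right_poly_def by (induction q rule: mpoly_induct) (auto split: var.split)
  then show ?thesis by (induction "is" arbitrary: p) simp_all
qed

text \<open>Fixing one group of variables at \<open>b\<close> and then evaluating the other at
  \<open>b\<close> sets \<open>a = x = b\<close>, whichever group comes first.\<close>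

lemma eval_left_poly: "mpoly_eval (\<lambda>i. b $ i) (left_poly b p) = mpoly_eval (\<lambda>i. b $ i) (diagonal p)"
  and eval_right_poly: "mpoly_eval (\<lambda>i. b $ i) (right_poly b p) = mpoly_eval (\<lambda>i. b $ i) (diagonal p)"
  unfolding left_poly_def right_poly_def diagonal_def mpoly_eval_subst
  by (rule arg_cong[where f = "\<lambda>f. mpoly_eval f p"]; auto simp: fun_eq_iff split: var.split)+

text \<open>This is the chain rule for the substitution \<open>a = x\<close>.\<close>

lemma partial_deriv_diagonal:
  "partial_deriv i (diagonal p)
    = diagonal (partial_deriv (AVar i) p) + diagonal (partial_deriv (XVar i) p)"
  unfolding diagonal_def
  by (induction p rule: mpoly_induct) (auto simp: algebra_simps split: var.split)

text \<open>The chain rule loses its \<open>x\<close>-term, and by commutation the hypothesis passes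
  on to every derivative of \<open>p\<close>.\<close>

lemma derivs_diagonal_AVar:
  assumes "\<And>i. partial_deriv (XVar i) p = 0"
  shows "derivs (\<lambda>i. i) is (diagonal p) = diagonal (derivs AVar is p)"
  using assms
proof (induction "is" arbitrary: p)
  case (Cons i "is")
  have "partial_deriv i (diagonal p) = diagonal (partial_deriv (AVar i) p)"
    using Cons.prems by (simp add: partial_deriv_diagonal) (simp add: diagonal_def)
  then show ?case
    using Cons.prems by (simp add: Cons.IH partial_deriv_commute[of "XVar _"])
qed simp

lemma derivs_diagonal_XVar:
  assumes "\<And>i. partial_deriv (AVar i) p = 0"
  shows "derivs (\<lambda>i. i) is (diagonal p) = diagonal (derivs XVar is p)"
  using assms
proof (induction "is" arbitrary: p)
  case (Cons i "is")
  have "partial_deriv i (diagonal p) = diagonal (partial_deriv (XVar i) p)"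
    using Cons.prems by (simp add: partial_deriv_diagonal) (simp add: diagonal_def)
  then show ?case
    using Cons.prems by (simp add: Cons.IH partial_deriv_commute[of "AVar _"])
qed simp

text \<open>Since \<open>\<partial>\<^sub>i\<close> of the restriction is the restriction of \<open>\<partial>/\<partial>a\<^sub>i + \<partial>/\<partial>x\<^sub>i\<close>, an
  \<open>a\<close>-derivative can be traded for an \<open>x\<close>-derivative at the cost of a sign as long as
  the restriction of the remaining derivative vanishes.\<close>

lemma diagonal_derivs_swap:
  assumes vanish: "\<And>is. length is < m \<Longrightarrow> set is \<subseteq> {..n} \<Longrightarrow> diagonal (derivs XVar is p) = 0"
  assumes "length is + length js \<le> m" and "set is \<subseteq> {..n}" and "set js \<subseteq> {..n}"
  shows "diagonal (derivs AVar is (derivs XVar js p))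
    = (-1) ^ length is * diagonal (derivs XVar (js @ is) p)"
  using assms(2-)
\<comment> \<open>The last index of the list is the outermost derivative, which is the one that the
  chain rule can trade.\<close>
proof (induction "is" arbitrary: js rule: rev_induct)
  case (snoc i "is")
  let ?q = "derivs AVar is (derivs XVar js p)"
  \<comment> \<open>The total order of \<open>?q\<close> is below \<open>m\<close>, so the induction
    hypothesis turns it into an \<open>x\<close>-derivative covered by
    \<open>vanish\<close>.\<close>
  have "diagonal ?q = 0"
    using snoc vanish[of "js @ is"] by simp
  then have "diagonal (partial_deriv (AVar i) ?q) = - diagonal (partial_deriv (XVar i) ?q)"
    using partial_deriv_diagonal[of i ?q] by (simp add: eq_neg_iff_add_eq_0)
  also have "partial_deriv (XVar i) ?q = derivs AVar is (derivs XVar (js @ [i]) p)"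
    by (simp add: partial_deriv_derivs[of "XVar i" AVar])
  also have "diagonal \<dots> = (-1) ^ length is * diagonal (derivs XVar ((js @ [i]) @ is) p)"
    using snoc.prems by (intro snoc.IH) auto
  also have "derivs XVar ((js @ [i]) @ is) p = derivs XVar (js @ is @ [i]) p"
    by (intro derivs_mset_cong[THEN fun_cong]) simp
  finally show ?case by simp
qed simp

subsection \<open>Euler's relation\<close>

text \<open>Homogeneity in \<open>x\<close> is encoded by Euler's relation, with the
  \<open>a\<close>-variables as coefficients. The degree is a ring element, so lowering it never
  truncates.\<close>

definition x_homogeneous :: "nat \<Rightarrow> 'a::comm_ring_1 \<Rightarrow> (var, 'a) mpoly \<Rightarrow> bool" where
  "x_homogeneous n c p \<longleftrightarrow> (\<Sum>i\<le>n. Var (XVar i) * partial_deriv (XVar i) p) = Const c * p"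

text \<open>The Euler operator is a derivation, so its eigenvalues add under products.\<close>

lemma x_homogeneous_mult:
  assumes "x_homogeneous n a p" and "x_homogeneous n c q"
  shows "x_homogeneous n (a + c) (p * q)"
proof -
  have "(\<Sum>i\<le>n. Var (XVar i) * partial_deriv (XVar i) (p * q))
      = (\<Sum>i\<le>n. Var (XVar i) * partial_deriv (XVar i) p) * q
        + p * (\<Sum>i\<le>n. Var (XVar i) * partial_deriv (XVar i) q)"
    by (simp add: sum.distrib sum_distrib_left sum_distrib_right algebra_simps)
  then show ?thesis
    using assms by (simp add: x_homogeneous_def Const_add algebra_simps)
qed

lemma x_homogeneous_const: "(\<And>i. partial_deriv (XVar i) p = 0) \<Longrightarrow> x_homogeneous n 0 p"
  by (simp add: x_homogeneous_def)

lemma x_homogeneous_Var: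
  assumes "i \<le> n"
  shows "x_homogeneous n 1 (Var (XVar i))"
proof -
  have "(\<Sum>k\<le>n. Var (XVar k) * partial_deriv (XVar k) (Var (XVar i)))
      = (\<Sum>k\<le>n. if k = i then Var (XVar i) else 0 :: (var, 'a) mpoly)"
    by (intro sum.cong) auto
  then show ?thesis using assms by (simp add: x_homogeneous_def)
qed

lemma x_homogeneous_power: "x_homogeneous n c p \<Longrightarrow> x_homogeneous n (of_nat k * c) (p ^ k)"
  by (induction k) (auto simp: algebra_simps intro: x_homogeneous_const dest: x_homogeneous_mult)

lemma x_homogeneous_prod:
  "(\<And>i. i \<in> S \<Longrightarrow> x_homogeneous n (c i) (f i)) \<Longrightarrow> x_homogeneous n (sum c S) (prod f S)"
  by (induction S rule: infinite_finite_induct)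
    (auto intro: x_homogeneous_const x_homogeneous_mult)

lemma x_homogeneous_sum:
  assumes "\<And>i. i \<in> S \<Longrightarrow> x_homogeneous n c (f i)"
  shows "x_homogeneous n c (sum f S)"
proof -
  have "(\<Sum>i\<le>n. Var (XVar i) * partial_deriv (XVar i) (sum f S))
      = (\<Sum>k\<in>S. \<Sum>i\<le>n. Var (XVar i) * partial_deriv (XVar i) (f k))"
    by (simp add: sum_distrib_left) (rule sum.swap)
  then show ?thesis using assms by (simp add: x_homogeneous_def sum_distrib_left)
qed

text \<open>Differentiating Euler's relation hits the factor \<open>Var (XVar j)\<close> once; the
  extra copy of the derivative lowers the eigenvalue by 1.\<close>

lemma x_homogeneous_partial_deriv:
  assumes "x_homogeneous n c p" and "j \<le> n"
  shows "x_homogeneous n (c - 1) (partial_deriv (XVar j) p)"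
proof -
  have "partial_deriv (XVar j) (\<Sum>i\<le>n. Var (XVar i) * partial_deriv (XVar i) p)
      = (\<Sum>i\<le>n. if i = j then partial_deriv (XVar j) p else 0)
        + (\<Sum>i\<le>n. Var (XVar i) * partial_deriv (XVar i) (partial_deriv (XVar j) p))"
    unfolding sum.distrib[symmetric] partial_deriv_sum
    by (intro sum.cong) (auto simp: partial_deriv_commute[of "XVar j"])
  moreover have "partial_deriv (XVar j) (\<Sum>i\<le>n. Var (XVar i) * partial_deriv (XVar i) p)
      = Const c * partial_deriv (XVar j) p"
    unfolding assms(1)[unfolded x_homogeneous_def] by simp
  ultimately show ?thesis
    using assms(2) by (simp add: x_homogeneous_def Const_diff algebra_simps)
qed

lemma x_homogeneous_derivs:
  assumes "x_homogeneous n c p" and "set is \<subseteq> {..n}"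
  shows "x_homogeneous n (c - of_nat (length is)) (derivs XVar is p)"
  using assms
proof (induction "is" arbitrary: c p)
  case (Cons i "is")
  from Cons.prems have "x_homogeneous n (c - 1) (partial_deriv (XVar i) p)"
    by (intro x_homogeneous_partial_deriv) auto
  from Cons.IH[OF this] Cons.prems(2) show ?case by (simp add: algebra_simps)
qed simp

text \<open>Descending from order \<open>k\<close>, Euler's relation expresses
  \<open>d - length is\<close> times a derivative through those of the next order. This factor is
  nonzero because \<open>length is \<le> k < d\<close> and the characteristic is 0.\<close>

lemma diagonal_derivs_eq_0_descend:
  fixes p :: "(var, 'a::field_char_0) mpoly"
  assumes hom: "x_homogeneous n (of_nat d) p" and "k < d"
    and top: "\<And>is. length is = k \<Longrightarrow> set is \<subseteq> {..n} \<Longrightarrow> diagonal (derivs XVar is p) = 0"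
    and "length is \<le> k" and "set is \<subseteq> {..n}"
  shows "diagonal (derivs XVar is p) = 0"
  using assms(4,5)
proof (induction "k - length is" arbitrary: "is")
  case 0
  then show ?case using top by simp
next
  case (Suc l)
  let ?c = "of_nat d - of_nat (length is) :: 'a" and ?q = "derivs XVar is p"
  have "diagonal (partial_deriv (XVar i) ?q) = 0" if "i \<le> n" for i
    using Suc.hyps(1)[of "is @ [i]"] Suc.hyps(2) Suc.prems that by simp
  then have "diagonal (\<Sum>i\<le>n. Var (XVar i) * partial_deriv (XVar i) ?q) = 0"
    by (simp add: diagonal_def)
  also have "(\<Sum>i\<le>n. Var (XVar i) * partial_deriv (XVar i) ?q) = Const ?c * ?q"
    using x_homogeneous_derivs[OF hom Suc.prems(2)] by (simp add: x_homogeneous_def)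
  finally have "Const ?c * diagonal ?q = 0"
    by (simp add: diagonal_def)
  \<comment> \<open>The scalar is inverted in the coefficient field and so cancels as a constant
    polynomial.\<close>
  then have "Const (1 / ?c * ?c) * diagonal ?q = 0"
    by (simp only: Const_mult mult.assoc mult_zero_right)
  moreover have "?c \<noteq> 0"
    using Suc.prems(1) \<open>k < d\<close> by simp
  ultimately show ?case by simp
qed

subsection \<open>The interpolation determinant\<close>

lemma monomial_row_index:
  "j < length E \<Longrightarrow>
    monomial_row n E q $ j = (\<Prod>i\<le>n. q i ^ Poly_Mapping.lookup (E ! j) i)"
  and dim_monomial_row: "dim_vec (monomial_row n E q) = length E"
  by (simp_all add: monomial_row_def vec_of_list_index)

context
  fixes n :: nat and E T :: "(nat \<Rightarrow>\<^sub>0 nat) list" and ps :: "'a::field_char_0 vec list"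
  assumes square: "length E = Suc (length T + length ps)"
begin

text \<open>Rows are counted from 0, so this is the row of monomials in \<open>x\<close>.\<close>

abbreviation (input) "last_row \<equiv> length T + length ps"
abbreviation (input) "M \<equiv> interpolation_matrix n E T ps"

lemma interpolation_matrix_carrier: "M \<in> carrier_mat (length E) (length E)"
  unfolding interpolation_matrix_def by (rule carrier_matI) (simp_all add: square)

lemma interpolation_matrix_deriv_row:
  assumes "k < length T" and "j < length E"
  shows "M $$ (k, j)
    = derivs AVar (exponent_list n (T ! k)) (\<Prod>i\<le>n. Var (AVar i) ^ Poly_Mapping.lookup (E ! j) i)"
  using assms
  by (simp add: interpolation_matrix_def mat_of_rows_index nth_append monomial_row_index
      dim_monomial_row iter_deriv_eq_derivs)

lemma interpolation_matrix_last_row: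
  assumes "j < length E"
  shows "M $$ (last_row, j) = (\<Prod>i\<le>n. Var (XVar i) ^ Poly_Mapping.lookup (E ! j) i)"
  using assms
  by (simp add: interpolation_matrix_def mat_of_rows_index nth_append monomial_row_index)

lemma partial_deriv_XVar_interpolation_matrix:
  assumes "k < last_row" and "j < length E"
  shows "partial_deriv (XVar i) (M $$ (k, j)) = 0"
proof (cases "k < length T")
  case True
  then show ?thesis
    using assms
    by (simp add: interpolation_matrix_deriv_row partial_deriv_derivs partial_deriv_prod_0
        partial_deriv_power_0)
next
  case False
  then show ?thesis
    using assms
    by (simp add: interpolation_matrix_def mat_of_rows_index nth_append monomial_row_index
        partial_deriv_prod_0 partial_deriv_power_0)
qed

text \<open>The cofactor deletes the only row in which \<open>x\<close> occurs.\<close>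

lemma partial_deriv_XVar_cofactor:
  "partial_deriv (XVar i) (cofactor M last_row j) = 0"
proof -
  have "partial_deriv (XVar i) (det (mat_delete M last_row j)) = 0"
    using interpolation_matrix_carrier square
    by (intro partial_deriv_det_0)
      (auto simp: mat_delete_def intro!: partial_deriv_XVar_interpolation_matrix)
  moreover have "partial_deriv (XVar i) ((-1) ^ k :: (var, 'a) mpoly) = 0" for k
    by (rule partial_deriv_power_0) simp
  ultimately show ?thesis by (simp add: cofactor_def)
qed

text \<open>Laplace expansion along the last row isolates the dependence on \<open>x\<close> in
  explicit monomials.\<close>

lemma det_interpolation_matrix:
  "det M = (\<Sum>j<length E. (\<Prod>i\<le>n. Var (XVar i) ^ Poly_Mapping.lookup (E ! j) i)
    * cofactor M last_row j)"
  using laplace_expansion_row[OF interpolation_matrix_carrier, of last_row] square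
  by (simp add: interpolation_matrix_last_row)

text \<open>The sum is an off-diagonal entry of \<open>M * adj_mat M\<close>, which is a scalar
  matrix.\<close>

lemma deriv_row_orthogonal:
  assumes "k < length T"
  shows "(\<Sum>j<length E. M $$ (k, j) * cofactor M last_row j) = 0"
proof -
  have "(M * adj_mat M) $$ (k, last_row) = 0"
    using assms square by (simp add: adj_mat(2)[OF interpolation_matrix_carrier])
  then show ?thesis
    using assms square interpolation_matrix_carrier
    by (simp add: adj_mat_def scalar_prod_def atLeast0LessThan)
qed

text \<open>In the expansion along the last row the monomials have degree \<open>d\<close> in
  \<open>x\<close> and the cofactors have degree 0.\<close>

lemma x_homogeneous_det_interpolation_matrix:
  assumes "set E \<subseteq> exponents n d"
  shows "x_homogeneous n (of_nat d) (det M)"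
proof -
  have "x_homogeneous n (of_nat d) (\<Prod>i\<le>n. Var (XVar i) ^ Poly_Mapping.lookup (E ! j) i :: (var, 'a) mpoly)"
    if "j < length E" for j
  proof -
    have "E ! j \<in> exponents n d" using that assms nth_mem by blast
    then have "(\<Sum>i\<le>n. of_nat (Poly_Mapping.lookup (E ! j) i) * 1) = (of_nat d :: 'a)"
      by (simp add: exponents_def flip: of_nat_sum)
    moreover have "x_homogeneous n (\<Sum>i\<le>n. of_nat (Poly_Mapping.lookup (E ! j) i) * 1)
        (\<Prod>i\<le>n. Var (XVar i) ^ Poly_Mapping.lookup (E ! j) i :: (var, 'a) mpoly)"
      by (intro x_homogeneous_prod x_homogeneous_power x_homogeneous_Var) simp
    ultimately show ?thesis by simp
  qed
  from x_homogeneous_mult[OF this x_homogeneous_const[OF partial_deriv_XVar_cofactor]]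
  show ?thesis
    unfolding det_interpolation_matrix by (intro x_homogeneous_sum) simp
qed

text \<open>Restricting an \<open>x\<close>-derivative of order \<open>k\<close> to the diagonal replaces the last row of the
  matrix by one of the rows of derivatives, so the determinant has two equal rows.\<close>

lemma diagonal_derivs_det_top:
  assumes "set T = exponents n k" and "length is = k" and "set is \<subseteq> {..n}"
  shows "diagonal (derivs XVar is (det M)) = 0"
proof -
  obtain t where t: "t \<in> exponents n k" "mset (exponent_list n t) = mset is"
    using exponents_of_list assms by metis
  then obtain l where l: "l < length T" "T ! l = t"
    using assms(1) by (metis in_set_conv_nth)
  let ?e = "\<lambda>j. Poly_Mapping.lookup (E ! j)" and ?C = "cofactor M last_row"
  \<comment> \<open>The monomials in \<open>x\<close> and in \<open>a\<close> have the same
    restriction, so both derivatives are compared with the derivative of that restriction.\<close>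
  have "diagonal (derivs XVar is (\<Prod>i\<le>n. Var (XVar i) ^ ?e j i)) = diagonal (M $$ (l, j))"
    if "j < length E" for j
  proof -
    have "diagonal (derivs XVar is (\<Prod>i\<le>n. Var (XVar i) ^ ?e j i))
        = derivs (\<lambda>i. i) is (diagonal (\<Prod>i\<le>n. Var (XVar i) ^ ?e j i) :: (nat, 'a) mpoly)"
      by (rule derivs_diagonal_XVar[symmetric]) (simp add: partial_deriv_prod_0 partial_deriv_power_0)
    also have "diagonal (\<Prod>i\<le>n. Var (XVar i) ^ ?e j i)
        = (diagonal (\<Prod>i\<le>n. Var (AVar i) ^ ?e j i) :: (nat, 'a) mpoly)"
      by (simp add: diagonal_def)
    also have "derivs (\<lambda>i. i) is \<dots> = diagonal (derivs AVar is (\<Prod>i\<le>n. Var (AVar i) ^ ?e j i))"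
      by (rule derivs_diagonal_AVar) (simp add: partial_deriv_prod_0 partial_deriv_power_0)
    also have "\<dots> = diagonal (M $$ (l, j))"
      using l that by (simp add: interpolation_matrix_deriv_row derivs_mset_cong[OF t(2)])
    finally show ?thesis .
  qed
  \<comment> \<open>The cofactors are free of \<open>x\<close>, so the derivatives act on the last
    row alone and turn it into row \<open>l\<close>.\<close>
  then have "diagonal (derivs XVar is (det M)) = diagonal (\<Sum>j<length E. M $$ (l, j) * ?C j)"
    by (simp add: det_interpolation_matrix derivs_sum derivs_mult_const partial_deriv_XVar_cofactor)
      (simp add: diagonal_def)
  then show ?thesis
    by (simp add: deriv_row_orthogonal[OF l(1)]) (simp add: diagonal_def)
qed

end

theorem theorem8:
  fixes n d m r :: nat
    and Z :: "'a::field_char_0 vec set set"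
    and P :: "nat \<Rightarrow> 'a vec set" and p :: "nat \<Rightarrow> 'a vec"
    and B :: "'a vec set" and b :: "'a vec"
    and E T :: "(nat \<Rightarrow>\<^sub>0 nat) list"
    and F :: "(var, 'a) mpoly" and F\<^sub>L F\<^sub>R :: "(nat, 'a) mpoly"
  assumes "Z \<subseteq> proj_space n" and "bij_betw P {1..r} Z"
    and "\<And>i. i \<in> {1..r} \<Longrightarrow> p i \<in> P i"
    and "d > 0" and "m > 0"
    and "(d + n) choose n = ((m + n - 1) choose n) + r + 1"
    and "distinct E" and "set E = exponents n d"
    and "distinct T" and "set T = exponents n (m - 1)"
    and "F = det (interpolation_matrix n E T (map p [1..<Suc r]))"
    and "B \<in> proj_space n" and "b \<in> B"
    and "F\<^sub>L = left_poly b F" and "F\<^sub>R = right_poly b F"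
    and "F\<^sub>L \<noteq> 0"
  shows "\<forall>t \<in> exponents n m.
    mpoly_eval (\<lambda>i. b $ i) (iter_deriv n (\<lambda>i. i) t F\<^sub>L)
      = (-1) ^ m * mpoly_eval (\<lambda>i. b $ i) (iter_deriv n (\<lambda>i. i) t F\<^sub>R)"
proof
  fix t assume t: "t \<in> exponents n m"
  let ?ps = "map p [1..<Suc r]" and ?is = "exponent_list n t"
  have "F \<noteq> 0"
    using assms(14,16) by (auto simp: left_poly_def)
  \<comment> \<open>The determinant of a non-square matrix is 0 by definition, so
    \<open>F \<noteq> 0\<close> already forces the row count.\<close>
  then have square: "length E = Suc (length T + length ?ps)"
    unfolding assms(11) by (auto simp: det_def interpolation_matrix_def split: if_splits)
  \<comment> \<open>Otherwise \<open>d + n \<le> m + n - 1\<close>, and monotonicity of binomials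
    contradicts the surplus \<open>r + 1\<close> in the dimension count.\<close>
  have "m - 1 < d"
  proof (rule ccontr)
    assume "\<not> m - 1 < d"
    then have "(d + n) choose n \<le> (m + n - 1) choose n"
      using assms(5) by (intro binomial_right_mono) linarith
    then show False using assms(6) by linarith
  qed
  have vanish: "diagonal (derivs XVar is F) = 0" if "length is < m" "set is \<subseteq> {..n}" for "is"
    unfolding assms(11)
  proof (rule diagonal_derivs_eq_0_descend)
    show "x_homogeneous n (of_nat d) (det (interpolation_matrix n E T ?ps))"
      by (rule x_homogeneous_det_interpolation_matrix[OF square]) (use assms(8) in simp)
    show "diagonal (derivs XVar js (det (interpolation_matrix n E T ?ps))) = 0"
      if "length js = m - 1" "set js \<subseteq> {..n}" for js
      by (rule diagonal_derivs_det_top[OF square assms(10) that])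
  qed (use that \<open>m - 1 < d\<close> in auto)
  \<comment> \<open>All \<open>m\<close> derivatives are traded, starting from no
    \<open>x\<close>-derivative; each trade needs vanishing only below order
    \<open>m\<close>.\<close>
  have "diagonal (derivs AVar ?is F) = (-1) ^ m * diagonal (derivs XVar ?is F)"
    using diagonal_derivs_swap[of m n F ?is "[]", OF vanish] length_exponent_list[OF t]
      set_exponent_list[of n t] by simp
  then have "mpoly_eval (\<lambda>i. b $ i) (diagonal (derivs AVar ?is F))
      = (-1) ^ m * mpoly_eval (\<lambda>i. b $ i) (diagonal (derivs XVar ?is F))"
    \<comment> \<open>Parity reduces the sign, a polynomial before evaluation and a scalar after it,
      to 1 or -1.\<close>
    by (cases "even m") (simp_all add: mpoly_eval_uminus)
  then show "mpoly_eval (\<lambda>i. b $ i) (iter_deriv n (\<lambda>i. i) t F\<^sub>L)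
      = (-1) ^ m * mpoly_eval (\<lambda>i. b $ i) (iter_deriv n (\<lambda>i. i) t F\<^sub>R)"
    unfolding assms(14,15) iter_deriv_eq_derivs derivs_left_poly derivs_right_poly
      eval_left_poly eval_right_poly
    \<comment> \<open>The identity above expresses the \<open>a\<close>-side by the
      \<open>x\<close>-side; the sign is its own inverse, which reverses it.\<close>
    by (cases "even m") simp_all
qed

end
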